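(* Let $p \ge 5$ be a prime and let $n := 2^{p-1}$. Let the integers $\phi_k(m)$ ($m \ge 0$ even, $k \ge 0$) be defined by the double-index recurrence relation $$\phi_k(m) = 4\,\phi_{k-1}(m-2) - \phi_k(m-4) \qquad (k \ge 2,\ m \ge 4 \text{ even}),$$ with the boundary values, for every even $m \ge 0$, $$\phi_0(m) = \begin{cases} 2 & m \equiv 0 \pmod 8\\ 0 & m \equiv \pm 2 \pmod 8\\ -2 & m \equiv 4 \pmod 8\end{cases}\qquad \phi_1(m) = \begin{cases} 2m & m \equiv 2 \pmod 8\\ 0 & m \equiv 0, 4 \pmod 8\\ -2m & m \equiv 6 \pmod 8\end{cases}$$ and $\phi_k(0) = \phi_k(2) = 0$ for all $k \ge 2$. Then $2^p - 1$ is prime if and only if $$2n-1 \ \Big|\ \sum_{\substack{k=0\\ k \text{ even}}}^{\lfloor n/2\rfloor} \phi_k(n).$$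
   Context: Note that $2n-1 = 2^p-1$. The divisibility is divisibility of integers. *)

theory Defs
  imports Complex_Main "HOL-Computational_Algebra.Primes"
begin

text \<open>
  Only even \<open>m\<close> is meaningful. If \<open>m\<close> is even, so are the arguments \<open>m - 2\<close> and \<open>m - 4\<close> of the
  recursive calls; hence the values at odd \<open>m\<close> never enter a value at even \<open>m\<close>. For even \<open>m\<close>,
  the condition \<open>m < 4\<close> says that \<open>m\<close> is \<open>0\<close> or \<open>2\<close>.
\<close>

fun phi :: "nat \<Rightarrow> nat \<Rightarrow> int" where
  "phi 0 m =
     (if m mod 8 = 0 then 2
      else if m mod 8 = 4 then - 2
      else 0)"
| "phi (Suc 0) m =
     (if m mod 8 = 2 then 2 * int m
      else if m mod 8 = 6 then - 2 * int m
      else 0)"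
| "phi (Suc (Suc k)) m =
     (if m < 4 then 0
      else 4 * phi (Suc k) (m - 2) - phi (Suc (Suc k)) (m - 4))"

lemma phi_boundary:
  assumes "k \<ge> 2"
  shows "phi k 0 = 0" and "phi k 2 = 0"
proof -
  obtain j where "k = Suc (Suc j)"
    using assms by (metis add_2_eq_Suc le_Suc_ex)
  then show "phi k 0 = 0" and "phi k 2 = 0" by simp_all
qed

lemma phi_rec:
  assumes "k \<ge> 2" "m \<ge> 4"
  shows "phi k m = 4 * phi (k - 1) (m - 2) - phi k (m - 4)"
proof -
  obtain j where "k = Suc (Suc j)"
    using assms(1) by (metis add_2_eq_Suc le_Suc_ex)
  with assms(2) show ?thesis by simp
qed

end

theory Submission
  imports Defs "HOL-Number_Theory.Number_Theory"
begin

text \<open>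
  The recurrence in \<open>k\<close> and \<open>m\<close> says that \<open>\<Sum>\<^sub>k \<phi>\<^sub>k(2j) x\<^sup>k\<close> is the Lucas polynomial \<open>V\<^sub>j(4x, 1)\<close>,
  which has the parity of \<open>j\<close>. At \<open>x = 1\<close> it becomes \<open>\<omega>\<^sup>j + \<omega>\<^sup>-\<^sup>j\<close> with \<open>\<omega> = 2 + \<surd>3\<close>, so for
  \<open>j = 2\<^sup>p\<^sup>-\<^sup>2\<close> the claim is the Lucas--Lehmer test: \<open>M = 2\<^sup>p - 1\<close> is prime iff \<open>M\<close> divides
  \<open>\<omega>\<^sup>N + 1\<close> in \<open>\<int>[\<surd>3]\<close>, where \<open>N = 2\<^sup>p\<^sup>-\<^sup>1\<close>. If \<open>M\<close> is prime, then \<open>2\<omega> = (1 + \<surd>3)\<^sup>2\<close>, the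
  Frobenius map and the fact that \<open>3\<close> is a nonresidue give the divisibility. Conversely, for a
  prime \<open>q\<close> dividing \<open>M\<close> the divisibility forces \<open>\<omega>\<close> to have order \<open>2\<^sup>p\<close> modulo \<open>q\<close>, hence
  \<open>2\<^sup>p \<le> q\<^sup>2\<close>, which is impossible for the least prime factor of a composite \<open>M\<close>.
\<close>

section \<open>The ring of integers with the square root of 3 adjoined\<close>

text \<open>A type of its own rather than a set of reals: the two coordinates decide divisibility by
  an integer and supply the residues that are counted later.\<close>

datatype zsqrt3 = ZSqrt3 (rat_part: int) (irr_part: int)

instantiation zsqrt3 :: comm_ring_1
begin

definition "0 = ZSqrt3 0 0"
definition "1 = ZSqrt3 1 0"
definition "x + y = ZSqrt3 (rat_part x + rat_part y) (irr_part x + irr_part y)"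
definition "x - y = ZSqrt3 (rat_part x - rat_part y) (irr_part x - irr_part y)"
definition "- x = ZSqrt3 (- rat_part x) (- irr_part x)"
definition "x * y = ZSqrt3 (rat_part x * rat_part y + 3 * irr_part x * irr_part y)
  (rat_part x * irr_part y + irr_part x * rat_part y)"

instance
  by standard
    (auto simp: zero_zsqrt3_def one_zsqrt3_def plus_zsqrt3_def minus_zsqrt3_def
      uminus_zsqrt3_def times_zsqrt3_def algebra_simps)

end

lemma zsqrt3_sel [simp]:
  "rat_part 0 = 0" "irr_part 0 = 0" "rat_part 1 = 1" "irr_part 1 = 0"
  "rat_part (x + y) = rat_part x + rat_part y" "irr_part (x + y) = irr_part x + irr_part y"
  "rat_part (x - y) = rat_part x - rat_part y" "irr_part (x - y) = irr_part x - irr_part y"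
  "rat_part (- x) = - rat_part x" "irr_part (- x) = - irr_part x"
  "rat_part (x * y) = rat_part x * rat_part y + 3 * irr_part x * irr_part y"
  "irr_part (x * y) = rat_part x * irr_part y + irr_part x * rat_part y"
  by (simp_all add: zero_zsqrt3_def one_zsqrt3_def plus_zsqrt3_def minus_zsqrt3_def
      uminus_zsqrt3_def times_zsqrt3_def)

lemma zsqrt3_of_nat [simp]: "rat_part (of_nat n) = int n" "irr_part (of_nat n) = 0"
  by (induction n) auto

lemma zsqrt3_of_int [simp]: "rat_part (of_int a) = a" "irr_part (of_int a) = 0"
  by (cases a; simp)+

lemma zsqrt3_numeral [simp]:
  "rat_part (numeral w) = numeral w" "irr_part (numeral w) = 0"
  using zsqrt3_of_int[of "numeral w"] by simp_all

lemma of_int_dvd_zsqrt3_iff: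
  "of_int q dvd x \<longleftrightarrow> q dvd rat_part x \<and> q dvd irr_part x"
proof
  assume "q dvd rat_part x \<and> q dvd irr_part x"
  then obtain a b where "rat_part x = q * a" "irr_part x = q * b"
    by (auto elim!: dvdE)
  then have "x = of_int q * ZSqrt3 a b"
    by (intro zsqrt3.expand) simp
  then show "of_int q dvd x" by simp
qed (auto elim!: dvdE)

definition sqrt3 :: zsqrt3 where "sqrt3 = ZSqrt3 0 1"
definition omega :: zsqrt3 where "omega = ZSqrt3 2 1"
definition omega_conj :: zsqrt3 where "omega_conj = ZSqrt3 2 (-1)"

lemma sqrt3_square: "sqrt3 * sqrt3 = 3"
  by (intro zsqrt3.expand) (simp add: sqrt3_def)

lemma omega_mult_conj: "omega * omega_conj = 1"
  by (intro zsqrt3.expand) (simp add: omega_def omega_conj_def)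

lemma omega_power_mult_conj_power: "omega ^ k * omega_conj ^ k = 1"
  by (simp add: omega_mult_conj flip: power_mult_distrib)

lemma two_omega: "2 * omega = (1 + sqrt3)\<^sup>2"
  by (intro zsqrt3.expand) (simp add: omega_def sqrt3_def power2_eq_square)

section \<open>The sum of the double-index sequence\<close>

text \<open>For \<open>Suc k\<close> at least 2 this is the defining recurrence. The linear factor
  in the values of \<open>phi 1\<close> makes it hold for \<open>k = 0\<close> too, so only the row
  \<open>phi 0\<close> is exceptional.\<close>

lemma phi_Suc_rec:
  assumes "even m"
  shows "phi (Suc k) (m + 4) = 4 * phi k (m + 2) - phi (Suc k) m"
proof (cases k)
  case 0
  have "m mod 8 = 0 \<or> m mod 8 = 2 \<or> m mod 8 = 4 \<or> m mod 8 = 6"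
    using assms by presburger
  then have "m mod 8 = 0 \<and> (m + 2) mod 8 = 2 \<and> (m + 4) mod 8 = 4
      \<or> m mod 8 = 2 \<and> (m + 2) mod 8 = 4 \<and> (m + 4) mod 8 = 6
      \<or> m mod 8 = 4 \<and> (m + 2) mod 8 = 6 \<and> (m + 4) mod 8 = 0
      \<or> m mod 8 = 6 \<and> (m + 2) mod 8 = 0 \<and> (m + 4) mod 8 = 2"
    using mod_add_left_eq[of m 8 2, symmetric] mod_add_left_eq[of m 8 4, symmetric]
    by (elim disjE) simp_all
  then show ?thesis
    using 0 by (elim disjE) (simp_all del: add_2_eq_Suc')
qed simp

lemma phi_0_rec: "phi 0 (m + 4) = - phi 0 m"
  by simp presburger

text \<open>Degree bound and parity of the Lucas polynomial: both conditions pass to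
  \<open>(j - 2, k)\<close> and \<open>(j - 1, k - 1)\<close>, the index pairs on the right of the
  recurrence.\<close>

lemma phi_eq_0:
  assumes "j < k \<or> odd (j + k)"
  shows "phi k (2 * j) = 0"
  using assms
proof (induction j arbitrary: k rule: less_induct)
  case (less j)
  show ?case
  proof (cases "j < 2")
    case True
    then consider "j = 0" | "j = 1" by linarith
    then show ?thesis
    proof cases
      case 1
      \<comment> \<open>\<open>phi.cases\<close> serves only to split \<open>k\<close> into 0, 1 and
        at least 2.\<close>
      then show ?thesis
        using less.prems by (cases "(k, j)" rule: phi.cases) auto
    next
      case 2
      then show ?thesis
        using less.prems by (cases "(k, j)" rule: phi.cases) auto
    qed
  next
    case False
    then obtain i where j: "j = i + 2"
      by (metis add.commute le_Suc_ex not_less)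
    have m: "2 * j = 2 * i + 4" "2 * i + 2 = 2 * (i + 1)"
      using j by auto
    show ?thesis
    proof (cases k)
      case 0
      then show ?thesis
        using less.IH[of i 0] less.prems j unfolding m(1) 0 phi_0_rec by simp
    next
      case (Suc l)
      show ?thesis
        using less.IH[of i k] less.IH[of "i + 1" l] less.prems j Suc
        unfolding m(1) Suc by (subst phi_Suc_rec) (auto simp del: phi.simps)
    qed
  qed
qed

text \<open>The Lucas recurrence \<open>V_(j+2) = 4x V_(j+1) - V_j\<close> at \<open>x = 1\<close>.
  The term \<open>k = 0\<close> is split off because the recurrence lowers \<open>k\<close>.\<close>

lemma sum_phi_rec:
  "(\<Sum>k\<le>j + 2. phi k (2 * (j + 2))) =
    4 * (\<Sum>k\<le>j + 1. phi k (2 * (j + 1))) - (\<Sum>k\<le>j. phi k (2 * j))"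
proof -
  have m: "2 * (j + 2) = 2 * j + 4" "2 * (j + 1) = 2 * j + 2"
    by auto
  have "(\<Sum>k\<le>j + 2. phi k (2 * (j + 2))) =
      phi 0 (2 * j + 4) + (\<Sum>k\<le>j + 1. phi (Suc k) (2 * j + 4))"
    unfolding m using sum.atMost_Suc_shift[of "\<lambda>k. phi k (2 * j + 4)" "j + 1"]
    by (simp del: phi.simps sum.atMost_Suc)
  also have "\<dots> = 4 * (\<Sum>k\<le>j + 1. phi k (2 * j + 2))
      - (phi 0 (2 * j) + (\<Sum>k\<le>j + 1. phi (Suc k) (2 * j)))"
    by (simp only: phi_0_rec phi_Suc_rec dvd_triv_left sum_subtractf sum_distrib_left)
  also have "phi 0 (2 * j) + (\<Sum>k\<le>j + 1. phi (Suc k) (2 * j)) = (\<Sum>k\<le>j + 2. phi k (2 * j))"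
    using sum.atMost_Suc_shift[of "\<lambda>k. phi k (2 * j)" "j + 1"]
    by (simp del: phi.simps sum.atMost_Suc)
  \<comment> \<open>The extra terms \<open>k = j + 1\<close> and \<open>k = j + 2\<close> lie above
    the degree.\<close>
  also have "\<dots> = (\<Sum>k\<le>j. phi k (2 * j))"
    by (simp add: phi_eq_0 del: phi.simps)
  finally show ?thesis
    unfolding m .
qed

text \<open>Both numbers are roots of \<open>x^2 - 4x + 1\<close>, so the two sides satisfy the same
  recurrence, with initial values 2 and 4.\<close>

lemma sum_phi_eq_omega:
  "of_int (\<Sum>k\<le>j. phi k (2 * j)) = omega ^ j + omega_conj ^ j"
proof (induction j rule: induct_nat_012)
  case (ge2 j)
  have "omega ^ (j + 2) = 4 * omega ^ (j + 1) - omega ^ j"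
  proof -
    have "omega\<^sup>2 = 4 * omega - 1"
      by (intro zsqrt3.expand) (simp add: omega_def power2_eq_square)
    then show ?thesis unfolding power_add by (simp only:) (simp add: algebra_simps)
  qed
  moreover have "omega_conj ^ (j + 2) = 4 * omega_conj ^ (j + 1) - omega_conj ^ j"
  proof -
    have "omega_conj\<^sup>2 = 4 * omega_conj - 1"
      by (intro zsqrt3.expand) (simp add: omega_conj_def power2_eq_square)
    then show ?thesis unfolding power_add by (simp only:) (simp add: algebra_simps)
  qed
  ultimately show ?case
    using ge2 sum_phi_rec[of j] by (simp del: phi.simps sum.atMost_Suc)
next
  case 1
  show ?case
    by (intro zsqrt3.expand) (simp add: omega_def omega_conj_def)
qed simp

lemma sum_even_phi:
  assumes "even j"
  shows "(\<Sum>k \<in> {k. k \<le> j \<and> even k}. phi k (2 * j)) = (\<Sum>k\<le>j. phi k (2 * j))"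
  using assms by (intro sum.mono_neutral_left) (auto simp: phi_eq_0 simp del: phi.simps)

text \<open>Multiplication by the unit \<open>omega ^ j\<close>, with inverse
  \<open>omega_conj ^ j\<close>, preserves divisibility and turns
  \<open>omega ^ j + omega_conj ^ j\<close> into \<open>omega ^ (2 * j) + 1\<close>.\<close>

lemma dvd_sum_phi_iff:
  "M dvd (\<Sum>k\<le>j. phi k (2 * j)) \<longleftrightarrow> of_int M dvd omega ^ (2 * j) + 1"
proof -
  let ?S = "of_int (\<Sum>k\<le>j. phi k (2 * j)) :: zsqrt3"
  have up: "omega ^ (2 * j) + 1 = omega ^ j * ?S"
    unfolding sum_phi_eq_omega distrib_left omega_power_mult_conj_power
    by (simp add: mult_2 power_add)
  have down: "?S = omega_conj ^ j * (omega ^ (2 * j) + 1)"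
    unfolding up mult.assoc[symmetric]
    by (simp only: mult.commute[of "omega_conj ^ j"] omega_power_mult_conj_power mult_1)
  have "M dvd (\<Sum>k\<le>j. phi k (2 * j)) \<longleftrightarrow> of_int M dvd ?S"
    by (simp add: of_int_dvd_zsqrt3_iff del: of_int_sum)
  also have "\<dots> \<longleftrightarrow> of_int M dvd omega ^ (2 * j) + 1"
    by (metis up down dvd_mult)
  finally show ?thesis .
qed

section \<open>The Lucas--Lehmer criterion\<close>

lemma diff_dvd_power_diff:
  fixes x y :: "'a :: comm_ring_1"
  shows "x - y dvd x ^ n - y ^ n"
proof (induction n)
  case (Suc n)
  have "x ^ Suc n - y ^ Suc n = x * (x ^ n - y ^ n) + (x - y) * y ^ n"
    by (simp add: algebra_simps)
  with Suc show ?case by (metis dvd_add dvd_mult dvd_triv_left)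
qed simp

text \<open>The Frobenius map modulo \<open>q\<close> is additive, since the inner binomial
  coefficients are multiples of \<open>q\<close>.\<close>

lemma prime_dvd_add_power_diff:
  fixes x y :: "'a :: comm_ring_1"
  assumes "prime q"
  shows "of_nat q dvd (x + y) ^ q - (x ^ q + y ^ q)"
proof -
  let ?f = "\<lambda>k. of_nat (q choose k) * x ^ k * y ^ (q - k)"
  have q: "q > 0" using assms prime_gt_0_nat by blast
  have "{..q} = insert 0 (insert q {1..<q})" using q by auto
  then have "(x + y) ^ q = ?f 0 + (?f q + sum ?f {1..<q})"
    using q by (simp add: binomial_ring)
  then have "(x + y) ^ q - (x ^ q + y ^ q) = sum ?f {1..<q}"
    by simp
  also have "of_nat q dvd \<dots>"
  proof (intro dvd_sum)
    fix k assume "k \<in> {1..<q}"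
    then have "q dvd q choose k" using assms by (intro dvd_choose_prime) auto
    then show "of_nat q dvd ?f k"
      by (metis dvd_mult2 of_nat_dvd_iff of_nat_mult dvdE dvd_triv_left)
  qed
  finally show ?thesis .
qed

section \<open>Necessity: arithmetic modulo a Mersenne prime\<close>

lemma mersenne_mod_3:
  assumes "odd p"
  shows "(2 ^ p - 1 :: int) mod 3 = 1"
proof -
  obtain k where "p = 2 * k + 1" using assms by (elim oddE)
  then have "(2 ^ p - 1 :: int) = 2 * 4 ^ k - 1" by (simp add: power_mult)
  moreover have "(4 :: int) ^ k mod 3 = 1"
    using power_mod[of "4 :: int" 3 k] by simp
  ultimately show ?thesis by presburger
qed

text \<open>Here \<open>q\<close> is 3 modulo 4 and 1 modulo 3, so reciprocity gives the Legendre
  symbol -1, and Euler's criterion turns it into the divisibility.\<close>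

lemma three_nonresidue_mersenne:
  assumes "prime (2 ^ p - 1 :: nat)" "odd p" "p \<ge> 3"
  defines "q \<equiv> 2 ^ p - 1 :: nat"
  shows "int q dvd 3 ^ ((q - 1) div 2) + 1"
proof -
  have p: "p = Suc (Suc (p - 2))" using assms by simp
  have "2 ^ 3 \<le> (2 :: nat) ^ p" using assms by (intro power_increasing) auto
  then have q: "q \<ge> 7" by (simp add: q_def)
  have iq: "int q = 2 ^ p - 1" by (simp add: q_def)
  have half: "(q - 1) div 2 = 2 ^ (p - 1) - 1"
    unfolding q_def by (subst p, subst (2) p) simp
  have "odd ((q - 1) div 2)"
    unfolding half by (subst p) simp
  then have "Legendre 3 (int q) * Legendre (int q) 3 = -1"
    using Quadratic_Reciprocity[of 3 q] q assms(1) by (simp add: q_def)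
  moreover have "Legendre (int q) 3 = 1"
  proof -
    have "int q mod 3 = 1" using mersenne_mod_3[OF assms(2)] iq by simp
    then have "[1 ^ 2 = int q] (mod 3)" "\<not> [int q = 0] (mod 3)"
      by (simp_all add: cong_def)
    then show ?thesis unfolding Legendre_def QuadRes_def by (auto intro!: exI[of _ 1])
  qed
  ultimately have "Legendre 3 (int q) = -1" by simp
  then have "[-1 = 3 ^ ((q - 1) div 2)] (mod int q)"
    using euler_criterion[of q 3] q assms(1) by (simp add: q_def)
  then have "int q dvd - 1 - 3 ^ ((q - 1) div 2)"
    by (simp only: cong_iff_dvd_diff)
  also have "\<dots> = - (3 ^ ((q - 1) div 2) + 1)" by simp
  finally show ?thesis by (simp only: dvd_minus_iff)
qed

text \<open>2 is a square modulo \<open>q\<close>, so its power with exponent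
  \<open>(q - 1) div 2 = 2 ^ (p - 1) - 1\<close> is 1 by Fermat; one more factor 2 gives the
  claim.\<close>

lemma mersenne_dvd_two_power:
  assumes "prime (2 ^ p - 1 :: nat)" "odd p"
  defines "q \<equiv> 2 ^ p - 1 :: nat"
  shows "int q dvd 2 ^ (2 ^ (p - 1)) - 2"
proof -
  obtain k where k: "p = 2 * k + 1" using assms by (elim oddE)
  \<comment> \<open>A square root of 2 modulo \<open>q\<close>: its square is
    \<open>2 ^ (p + 1) = 2 * (q + 1)\<close>.\<close>
  define x where "x = (2 :: nat) ^ (k + 1)"
  have "\<not> q dvd 2 ^ m" for m
  proof
    assume "q dvd 2 ^ m"
    then have "q dvd 2" using assms(1) prime_dvd_power q_def by blast
    then have "q = 2" using assms(1) by (metis q_def primes_dvd_imp_eq two_is_prime_nat)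
    moreover have "odd q" using k by (simp add: q_def)
    ultimately show False by simp
  qed
  then have "[x ^ (q - 1) = 1] (mod q)"
    using assms(1) fermat_theorem unfolding q_def x_def by blast
  then have "[int x ^ (q - 1) = 1] (mod int q)"
    by (metis cong_int_iff of_nat_1 of_nat_power)
  then have 1: "int q dvd int x ^ (q - 1) - 1"
    by (simp add: cong_iff_dvd_diff)
  have "(2 :: nat) ^ p = 2 * 2 ^ (p - 1)" using k by simp
  then have e: "q - 1 = 2 * (2 ^ (p - 1) - 1)" unfolding q_def by simp
  have x2: "int x ^ 2 = 2 + 2 * int q"
  proof -
    have "int x ^ 2 = 2 * 2 ^ p"
      using k by (simp add: x_def power_mult[symmetric] power_add mult.commute)
    then show ?thesis by (simp add: q_def)
  qed
  have "int q dvd int x ^ 2 - 2" using x2 by simp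
  also have "\<dots> dvd (int x ^ 2) ^ (2 ^ (p - 1) - 1) - 2 ^ (2 ^ (p - 1) - 1)"
    by (rule diff_dvd_power_diff)
  finally have "int q dvd int x ^ (q - 1) - 2 ^ (2 ^ (p - 1) - 1)"
    unfolding e by (simp only: power_mult)
  with 1 have "int q dvd 2 * ((int x ^ (q - 1) - 1) - (int x ^ (q - 1) - 2 ^ (2 ^ (p - 1) - 1)))"
    by (intro dvd_mult) (rule dvd_diff)
  also have "\<dots> = 2 * 2 ^ (2 ^ (p - 1) - 1) - 2" by simp
  also have "2 * 2 ^ (2 ^ (p - 1) - 1) = (2 :: int) ^ (2 ^ (p - 1))"
    by (metis power_eq_if power_not_zero zero_neq_numeral)
  finally show ?thesis .
qed

text \<open>Compute \<open>(1 + sqrt3) ^ (q + 1)\<close> in two ways. It equals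
  \<open>2 ^ N * omega ^ N\<close>; by Frobenius and \<open>sqrt3 ^ q\<close> being congruent to
  \<open>- sqrt3\<close>, it is congruent to \<open>(1 + sqrt3) * (1 - sqrt3) = - 2\<close>.\<close>

lemma mersenne_prime_imp_dvd:
  assumes "prime (2 ^ p - 1 :: nat)" "odd p" "p \<ge> 3"
  shows "of_int (2 ^ p - 1) dvd omega ^ (2 ^ (p - 1)) + 1"
proof -
  define q :: nat where "q = 2 ^ p - 1"
  define N :: nat where "N = 2 ^ (p - 1)"
  define Q :: zsqrt3 where "Q = of_nat q"
  have "(2 :: nat) ^ p = 2 * N" using assms(3) unfolding N_def by (cases p) auto
  moreover have "N \<ge> 1" by (simp add: N_def)
  ultimately have qN: "q + 1 = 2 * N" "(q - 1) div 2 = N - 1" "q = 2 * (N - 1) + 1"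
    by (auto simp: q_def)
  have lift: "Q dvd of_int a" if "int q dvd a" for a
    using that by (metis Q_def dvdE dvd_triv_left of_int_mult of_int_of_nat_eq)
  have frob: "Q dvd (1 + sqrt3) ^ q - (1 + sqrt3 ^ q)"
    using prime_dvd_add_power_diff[of q 1 sqrt3] assms(1) by (simp add: Q_def q_def)
  have "sqrt3 ^ q = 3 ^ (N - 1) * sqrt3"
    unfolding qN(3) by (simp add: power_add power_mult power2_eq_square sqrt3_square)
  moreover have "Q dvd 3 ^ (N - 1) + 1"
    using lift[OF three_nonresidue_mersenne[OF assms, folded q_def]] by (simp add: qN)
  ultimately have s: "Q dvd sqrt3 ^ q + sqrt3"
    by (metis distrib_right dvd_mult2 mult_1)
  have "Q dvd (1 + sqrt3) * (((1 + sqrt3) ^ q - (1 + sqrt3 ^ q)) + (sqrt3 ^ q + sqrt3))"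
    by (intro dvd_mult dvd_add frob s)
  also have "\<dots> = (1 + sqrt3) ^ (q + 1) - (1 + sqrt3) * (1 - sqrt3)"
    by (simp add: algebra_simps)
  also have "(1 + sqrt3) * (1 - sqrt3) = - 2"
    by (simp add: algebra_simps sqrt3_square)
  also have "(1 + sqrt3) ^ (q + 1) = 2 ^ N * omega ^ N"
    unfolding qN(1) by (simp add: power_mult two_omega flip: power_mult_distrib)
  finally have a: "Q dvd 2 ^ N * omega ^ N + 2" by simp
  have b: "Q dvd 2 ^ N - 2"
    using lift[OF mersenne_dvd_two_power[OF assms(1,2), folded q_def]] by (simp add: N_def)
  \<comment> \<open>The difference is \<open>2 * (omega ^ N + 1)\<close>. The factor
    \<open>N\<close> cancels the 2, because \<open>2 * N = q + 1\<close> is 1 modulo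
    \<open>q\<close>.\<close>
  have c: "Q dvd of_nat N * ((2 ^ N * omega ^ N + 2) - (2 ^ N - 2) * omega ^ N)"
    by (intro dvd_mult dvd_diff a dvd_mult2 b)
  have "of_nat N * ((2 ^ N * omega ^ N + 2) - (2 ^ N - 2) * omega ^ N)
      = of_nat (2 * N) * (omega ^ N + 1)"
    by (simp add: algebra_simps)
  also have "\<dots> = Q * (omega ^ N + 1) + (omega ^ N + 1)"
    unfolding Q_def qN(1)[symmetric] by (simp add: algebra_simps)
  finally have "Q dvd omega ^ N + 1"
    using c by (metis dvd_add_right_iff dvd_triv_left)
  moreover have "of_int (2 ^ p - 1) = Q" by (simp add: Q_def q_def)
  ultimately show ?thesis by (simp add: N_def)
qed

section \<open>Sufficiency: the order of \<open>omega\<close> modulo a prime factor\<close>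

lemma composite_obtains_prime_square_le:
  fixes m :: nat
  assumes "m > 1" "\<not> prime m"
  obtains q where "prime q" "q dvd m" "q * q \<le> m"
proof -
  obtain a where a: "a dvd m" "a \<noteq> 1" "a \<noteq> m"
    using assms by (auto simp: prime_nat_iff)
  then obtain b where b: "m = a * b" by (elim dvdE)
  \<comment> \<open>The smaller of two complementary divisors has square at most \<open>m\<close>,
    and so has each of its prime factors.\<close>
  define c where "c = min a b"
  have c: "c dvd m" "c \<noteq> 1" "c * c \<le> m"
    using a b by (auto simp: c_def min_def mult_le_mono)
  obtain q where q: "prime q" "q dvd c" using c(2) prime_factor_nat by blast
  moreover have "c > 0" using c(1) assms(1) by (cases c) auto
  then have "q * q \<le> c * c" using q(2) by (intro mult_le_mono) (auto intro: dvd_imp_le)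
  ultimately show ?thesis using that c by (meson dvd_trans order_trans)
qed

text \<open>Write \<open>d = 2 ^ s * t\<close> with \<open>t\<close> odd and \<open>s < p\<close>.
  If \<open>omega ^ d\<close> were 1 modulo \<open>q\<close>, its power with exponent
  \<open>2 ^ (p - 1 - s)\<close> would be 1, but it is also
  \<open>(omega ^ (2 ^ (p - 1))) ^ t\<close>, hence -1.\<close>

lemma omega_power_not_one:
  assumes q: "\<not> q dvd 2" and "of_int q dvd omega ^ (2 ^ (p - 1)) + 1" and d: "0 < d" "d < 2 ^ p"
  shows "\<not> of_int q dvd omega ^ d - 1"
proof
  assume dvd: "of_int q dvd omega ^ d - 1"
  obtain t where t: "d = 2 ^ multiplicity 2 d * t" "odd t"
    using multiplicity_decompose'[of d 2] d(1) by auto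
  define s where "s = multiplicity 2 d"
  have "2 ^ s \<le> d" using d t by (metis dvd_imp_le multiplicity_dvd s_def)
  then have "(2 :: nat) ^ s < 2 ^ p" using d by linarith
  then have "s < p" by simp
  then have "(2 :: nat) ^ (p - 1) = 2 ^ s * 2 ^ (p - 1 - s)"
    by (simp flip: power_add)
  then have e: "d * 2 ^ (p - 1 - s) = 2 ^ (p - 1) * t"
    using t(1) unfolding s_def[symmetric] by simp
  have "of_int q dvd (omega ^ d) ^ (2 ^ (p - 1 - s)) - 1 ^ (2 ^ (p - 1 - s))"
    using dvd diff_dvd_power_diff dvd_trans by blast
  then have 1: "of_int q dvd (omega ^ (2 ^ (p - 1))) ^ t - 1"
    by (simp only: e power_one flip: power_mult)
  have "of_int q dvd omega ^ (2 ^ (p - 1)) - (- 1)"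
    using assms(2) by simp
  then have "of_int q dvd (omega ^ (2 ^ (p - 1))) ^ t - (- 1) ^ t"
    using diff_dvd_power_diff dvd_trans by blast
  then have "of_int q dvd (omega ^ (2 ^ (p - 1))) ^ t + 1"
    using t(2) by simp
  from dvd_diff[OF this 1] have "of_int q dvd (2 :: zsqrt3)" by simp
  then show False using q by (simp add: of_int_dvd_zsqrt3_iff)
qed

text \<open>Pigeonhole: the first \<open>2 ^ p\<close> powers of \<open>omega\<close> are distinct
  modulo \<open>q\<close>, and there are only \<open>q * q\<close> pairs of residues.\<close>

lemma two_power_le_square:
  assumes "q > 0" "\<not> int q dvd 2" and "of_nat q dvd omega ^ (2 ^ (p - 1)) + 1"
  shows "2 ^ p \<le> q * q"
proof -
  let ?f = "\<lambda>k. (rat_part (omega ^ k) mod int q, irr_part (omega ^ k) mod int q)"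
  have neq: "?f i \<noteq> ?f j" if "i < j" "j < 2 ^ p" for i j
  proof
    assume "?f i = ?f j"
    then have "?f j = ?f i" ..
    then have "of_int (int q) dvd omega ^ j - omega ^ i"
      by (simp add: of_int_dvd_zsqrt3_iff mod_eq_dvd_iff del: of_int_of_nat_eq)
    \<comment> \<open>The inverse of \<open>omega ^ i\<close> cancels the common factor.\<close>
    then have "of_int (int q) dvd omega_conj ^ i * (omega ^ j - omega ^ i)" by (rule dvd_mult)
    also have "omega ^ j = omega ^ i * omega ^ (j - i)"
      using that(1) by (simp flip: power_add)
    also have "omega_conj ^ i * (omega ^ i * omega ^ (j - i) - omega ^ i)
        = (omega ^ i * omega_conj ^ i) * (omega ^ (j - i) - 1)"
      by (simp add: algebra_simps)
    finally have "of_int (int q) dvd omega ^ (j - i) - 1"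
      by (simp only: omega_power_mult_conj_power mult_1)
    then show False
      using omega_power_not_one[of "int q" p "j - i"] assms(2,3) that
      by (simp add: less_imp_diff_less)
  qed
  have "inj_on ?f {..<2 ^ p}"
  proof (rule linorder_inj_onI)
    fix i j :: nat assume "i < j" "j \<in> {..<2 ^ p}"
    with neq show "?f i \<noteq> ?f j" by blast
  qed auto
  moreover have "?f ` {..<2 ^ p} \<subseteq> {0..<int q} \<times> {0..<int q}"
    using assms(1) by auto
  ultimately have "card {..<2 ^ p :: nat} \<le> card ({0..<int q} \<times> {0..<int q})"
    by (intro card_inj_on_le) auto
  then show ?thesis by (simp add: card_cartesian_product)
qed

lemma dvd_imp_mersenne_prime:
  assumes "p \<ge> 2" and "of_int (2 ^ p - 1) dvd omega ^ (2 ^ (p - 1)) + 1"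
  shows "prime (2 ^ p - 1 :: nat)"
proof (rule ccontr)
  assume "\<not> prime (2 ^ p - 1 :: nat)"
  moreover have "2 ^ 2 \<le> (2 :: nat) ^ p" using assms by (intro power_increasing) auto
  then have "2 ^ p - 1 > (1 :: nat)" by simp
  ultimately obtain q :: nat where q: "prime q" "q dvd 2 ^ p - 1" "q * q \<le> 2 ^ p - 1"
    using composite_obtains_prime_square_le[of "2 ^ p - 1"] by blast
  have "odd (2 ^ p - 1 :: nat)" using assms(1) by simp
  then have "odd q" using q(2) dvd_trans by blast
  then have "\<not> int q dvd 2"
    using q(1) by (metis int_dvd_int_iff of_nat_numeral primes_dvd_imp_eq two_is_prime_nat dvd_refl)
  moreover have "of_nat q dvd omega ^ (2 ^ (p - 1)) + 1"
  proof -
    have "(of_nat q :: zsqrt3) dvd of_nat (2 ^ p - 1)"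
      using q(2) by (metis dvdE dvd_triv_left of_nat_mult)
    also have "(of_nat (2 ^ p - 1) :: zsqrt3) = of_int (2 ^ p - 1)" by simp
    finally show ?thesis using assms(2) dvd_trans by blast
  qed
  ultimately have "2 ^ p \<le> q * q"
    using q(1) by (intro two_power_le_square prime_gt_0_nat)
  with q(3) show False
    by (metis One_nat_def diff_less le_trans less_numeral_extra(1) not_less zero_less_numeral zero_less_power)
qed

theorem theorem3:
  fixes p n :: nat
  assumes "prime p" and "p \<ge> 5" and "n = 2 ^ (p - 1)"
  shows "prime (2 ^ p - 1 :: nat) \<longleftrightarrow>
    (2 * int n - 1) dvd (\<Sum>k \<in> {k. k \<le> n div 2 \<and> even k}. phi k n)"
proof -
  have "odd p" using assms prime_odd_nat by auto
  define j :: nat where "j = 2 ^ (p - 2)"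
  have p: "p = Suc (Suc (p - 2))" using assms(2) by simp
  have n: "n = 2 * j" unfolding assms(3) j_def by (subst p) simp
  \<comment> \<open>Parity of \<open>j = n div 2\<close> is what lets the sum over even
    \<open>k\<close> be replaced by the full sum.\<close>
  have "even j" using assms(2) by (simp add: j_def)
  have M: "2 * int n - 1 = 2 ^ p - 1" unfolding assms(3) by (subst (2) p) (subst p, simp)
  have "(2 * int n - 1) dvd (\<Sum>k \<in> {k. k \<le> n div 2 \<and> even k}. phi k n) \<longleftrightarrow>
      2 ^ p - 1 dvd (\<Sum>k\<le>j. phi k (2 * j))"
    unfolding M using sum_even_phi[OF \<open>even j\<close>] by (simp add: n del: phi.simps)
  also have "\<dots> \<longleftrightarrow> of_int (2 ^ p - 1) dvd omega ^ (2 ^ (p - 1)) + 1"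
    unfolding dvd_sum_phi_iff by (simp only: n[symmetric] assms(3))
  also have "\<dots> \<longleftrightarrow> prime (2 ^ p - 1 :: nat)"
    using mersenne_prime_imp_dvd dvd_imp_mersenne_prime \<open>odd p\<close> assms(2) by auto
  finally show ?thesis ..
qed

end
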